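(* Let $m\ge2$, and let $f,g\in\mathbb{C}[x,y]$ be $m$-homogeneous polynomials which are nondegenerate in the sense that $f(x,y)=g(x,y)=0$ implies $x=y=0$. Write $f_1(z):=f(1,z)$, $g_1(z):=g(1,z)$, $P(z):=-zf_1(z)+g_1(z)$, and consider the blow-up system $$\dot u=-u\,f_1(z),\qquad \dot z=P(z)\qquad(\ast)$$ in complex time $t_1$. Let $z=e_j$ be any simple zero of $P$. Then the linearization of $(\ast)$ at the equilibrium $(u,z)=(0,e_j)$ is diagonal, with eigenvalues $$\lambda_1=-f_1(e_j)\neq0,\qquad \lambda_2=P'(e_j)\neq0.$$ The holonomy of $u$ over $z$ near $z=e_j$ is also linear, with holonomy multiplier $\exp(2\pi \mathrm{i}\lambda)$ determined by the spectral ratio $\lambda=\lambda_1/\lambda_2=-f_1(e_j)/P'(e_j)$. Assume (i) either, Siegel spectrum of saddle type, i.e. negative spectral ratio $\lambda=\lambda_1/\lambda_2<0$, (ii) or else, nonresonant Poincaré spectrum of node type, i.e. with spectral ratio $0<\lambda,\,1/\lambda\in(\mathbb{Q}\setminus\mathbb{Z})\cup\{1\}$. In the nonresonant Poincaré case (ii) with real eigenvalues $\lambda_1,\lambda_2$, there is a local analytic flow linearization of $(\ast)$ at $(0,e_j)$ to diagonal form. The complex case (ii) (nonreal eigenvalues) reduces to the real case after a complex rotation in time. The complex nonresonant Poincaré case (ii), and the general Siegel case (i), only support local analytic orbit diagonalization at $(0,e_j)$.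
   Context: System $(\ast)$ arises from $\dot x=f(x,y)$, $\dot y=g(x,y)$ by $u=1/x$, $z=y/x$ and time rescaling $dt=u^{m-1}dt_1$. Leafs are the nonstationary solution orbits in complex time. Holonomy of $u$ over $z$: fix $z_0\neq e_j$ near $e_j$ and a small positively oriented simple closed curve $\gamma^z$ around $e_j$ based at $z_0$; label leafs over $z=z_0$ by $u_0$. Following the leaf through $(u_0,z_0)$ once over $\gamma^z$ leads to a point $(u_1,z_0)$; the holonomy map is $u_0\mapsto u_1$. If it is linear, $u_1=\mu u_0$, then $\mu$ is the holonomy multiplier. Local analytic flow linearization (to diagonal form): a local biholomorphism, mapping $(0,e_j)$ to the origin, conjugates the local flow of $(\ast)$ in complex time to the flow of the linear diagonal system $\dot{\tilde u}=\lambda_1\tilde u$, $\dot{\tilde z}=\lambda_2\tilde z$. Local analytic orbit diagonalization: a local biholomorphism maps complex-time orbits of $(\ast)$ to orbits of that linear diagonal system, as sets.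
   Formalization: "Only support local analytic orbit diagonalization" is stated as existence of an orbit diagonalization; the exclusion of flow linearization suggested by "only" is dropped as false (f=x², g=2xy+y², e=0: w=z/(1+z) linearizes the flow). *)

theory Defs
  imports "HOL-Complex_Analysis.Complex_Analysis"
begin

text \<open>
  The ring \<open>\<complex>[x, y]\<close> is \<^typ>\<open>complex poly poly\<close>, read as \<open>\<complex>[x][y]\<close>: the coefficient of
  \<open>x\<^sup>i y\<^sup>j\<close> in \<open>p\<close> is \<open>coeff (coeff p j) i\<close>.
\<close>

definition homogeneous :: "nat \<Rightarrow> complex poly poly \<Rightarrow> bool" where
  "homogeneous m p \<longleftrightarrow> (\<forall>i j. coeff (coeff p j) i \<noteq> 0 \<longrightarrow> i + j = m)"

definition subst_x :: "complex poly poly \<Rightarrow> complex \<Rightarrow> complex poly" where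
  "subst_x p x = map_poly (\<lambda>c. poly c x) p"

definition eval2 :: "complex poly poly \<Rightarrow> complex \<Rightarrow> complex \<Rightarrow> complex" where
  "eval2 p x y = poly (subst_x p x) y"

lemma eval2_conv_poly_poly: "eval2 p x y = poly (poly p [:y:]) x"
  unfolding eval2_def subst_x_def
  by (induction p) (auto simp: map_poly_pCons)

definition nondegenerate :: "complex poly poly \<Rightarrow> complex poly poly \<Rightarrow> bool" where
  "nondegenerate f g \<longleftrightarrow> (\<forall>x y. eval2 f x y = 0 \<and> eval2 g x y = 0 \<longrightarrow> x = 0 \<and> y = 0)"

text \<open>The dehomogenization \<open>p\<^sub>1(z) = p(1, z)\<close>, as a polynomial in \<open>z\<close>.\<close>

definition dehom :: "complex poly poly \<Rightarrow> complex poly" where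
  "dehom p = subst_x p 1"

definition Ppoly :: "complex poly poly \<Rightarrow> complex poly poly \<Rightarrow> complex poly" where
  "Ppoly f g = - ([:0, 1:] * dehom f) + dehom g"

text \<open>The conjunct \<open>p \<noteq> 0\<close> is needed because \<open>order e 0\<close> is unspecified.\<close>

definition simple_zero :: "complex poly \<Rightarrow> complex \<Rightarrow> bool" where
  "simple_zero p e \<longleftrightarrow> p \<noteq> 0 \<and> order e p = 1"

type_synonym C2 = "complex \<times> complex"

definition cscale :: "complex \<Rightarrow> C2 \<Rightarrow> C2" where
  "cscale c p = (c * fst p, c * snd p)"

definition blowup_field :: "complex poly poly \<Rightarrow> complex poly poly \<Rightarrow> C2 \<Rightarrow> C2" where
  "blowup_field f g = (\<lambda>(u, z). (- u * poly (dehom f) z, poly (Ppoly f g) z))"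

definition diag_map :: "complex \<Rightarrow> complex \<Rightarrow> C2 \<Rightarrow> C2" where
  "diag_map a b = (\<lambda>(v, w). (a * v, b * w))"

definition eigenvalues :: "(C2 \<Rightarrow> C2) \<Rightarrow> complex set" where
  "eigenvalues A = {\<mu>. \<exists>v. v \<noteq> 0 \<and> A v = cscale \<mu> v}"

definition lambda1 :: "complex poly poly \<Rightarrow> complex \<Rightarrow> complex" where
  "lambda1 f e = - poly (dehom f) e"

definition lambda2 :: "complex poly poly \<Rightarrow> complex poly poly \<Rightarrow> complex \<Rightarrow> complex" where
  "lambda2 f g e = poly (pderiv (Ppoly f g)) e"

definition spectral_ratio :: "complex poly poly \<Rightarrow> complex poly poly \<Rightarrow> complex \<Rightarrow> complex" where
  "spectral_ratio f g e = lambda1 f e / lambda2 f g e"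

definition siegel_saddle :: "complex \<Rightarrow> bool" where
  "siegel_saddle l \<longleftrightarrow> l \<in> \<real> \<and> Re l < 0"

text \<open>
  The condition is imposed on both \<open>l\<close> and \<open>1 / l\<close>; thus the resonant ratios
  \<open>2, 3, \<dots>\<close> and \<open>1/2, 1/3, \<dots>\<close> are both excluded.
\<close>

definition nonresonant_node :: "complex \<Rightarrow> bool" where
  "nonresonant_node l \<longleftrightarrow>
     (\<forall>r \<in> {l, 1 / l}. r \<in> \<real> \<and> 0 < Re r \<and> r \<in> (\<rat> - \<int>) \<union> {1})"

text \<open>The derivative below is \<open>h \<mapsto> h \<cdot> X (\<eta> t)\<close> for complex \<open>h\<close>, so \<open>\<eta>\<close> is holomorphic.\<close>

definition is_solution :: "(C2 \<Rightarrow> C2) \<Rightarrow> complex set \<Rightarrow> (complex \<Rightarrow> C2) \<Rightarrow> bool" where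
  "is_solution X D \<eta> \<longleftrightarrow> open D \<and> connected D \<and>
     (\<forall>t\<in>D. (\<eta> has_derivative (\<lambda>h. cscale h (X (\<eta> t)))) (at t))"

text \<open>
  The local flow in \<open>U\<close> takes \<open>p\<close> to \<open>q\<close> in complex time \<open>t\<close>, along a solution that stays in
  \<open>U\<close>. It is a relation because the solution through \<open>p\<close>, restricted to those times at which it
  is in \<open>U\<close>, may be multivalued.
\<close>

definition local_flow :: "(C2 \<Rightarrow> C2) \<Rightarrow> C2 set \<Rightarrow> complex \<Rightarrow> C2 \<Rightarrow> C2 \<Rightarrow> bool" where
  "local_flow X U t p q \<longleftrightarrow>
     (\<exists>D \<eta>. is_solution X D \<eta> \<and> \<eta> ` D \<subseteq> U \<and> 0 \<in> D \<and> t \<in> D \<and> \<eta> 0 = p \<and> \<eta> t = q)"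

text \<open>
  A path \<open>c\<close> on \<open>[0, 1]\<close> that moves within a single complex-time orbit: near each parameter
  value, \<open>c\<close> is a solution evaluated along a continuous complex time path \<open>\<tau>\<close>. This allows
  analytic continuation of solutions along paths.
\<close>

definition orbit_path :: "(C2 \<Rightarrow> C2) \<Rightarrow> (real \<Rightarrow> C2) \<Rightarrow> bool" where
  "orbit_path X c \<longleftrightarrow>
     (\<forall>s\<in>{0..1}. \<exists>\<epsilon>>0. \<exists>D \<eta> \<tau>. is_solution X D \<eta> \<and>
        continuous_on ({0..1} \<inter> ball s \<epsilon>) \<tau> \<and>
        (\<forall>s'\<in>{0..1} \<inter> ball s \<epsilon>. \<tau> s' \<in> D \<and> c s' = \<eta> (\<tau> s')))"

definition local_orbit :: "(C2 \<Rightarrow> C2) \<Rightarrow> C2 set \<Rightarrow> C2 \<Rightarrow> C2 set" where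
  "local_orbit X U p =
     {q. \<exists>c. orbit_path X c \<and> c ` {0..1} \<subseteq> U \<and> pathstart c = p \<and> pathfinish c = q}"

text \<open>Leafs are the nonstationary orbits.\<close>

definition leaf_path :: "(C2 \<Rightarrow> C2) \<Rightarrow> (real \<Rightarrow> C2) \<Rightarrow> bool" where
  "leaf_path X c \<longleftrightarrow> orbit_path X c \<and> (\<forall>s\<in>{0..1}. X (c s) \<noteq> 0)"

text \<open>Following the leaf through \<open>(u0, \<gamma> 0)\<close> over the curve \<open>\<gamma>\<close> in the \<open>z\<close>-plane leads to
  \<open>(u1, \<gamma> 1)\<close>.\<close>

definition holonomy_rel ::
    "(C2 \<Rightarrow> C2) \<Rightarrow> (real \<Rightarrow> complex) \<Rightarrow> complex \<Rightarrow> complex \<Rightarrow> bool" where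
  "holonomy_rel X \<gamma> u0 u1 \<longleftrightarrow>
     (\<exists>c. leaf_path X c \<and> (\<forall>s\<in>{0..1}. snd (c s) = \<gamma> s) \<and>
          pathstart c = (u0, pathstart \<gamma>) \<and> pathfinish c = (u1, pathfinish \<gamma>))"

definition is_holonomy_map ::
    "(C2 \<Rightarrow> C2) \<Rightarrow> (real \<Rightarrow> complex) \<Rightarrow> (complex \<Rightarrow> complex) \<Rightarrow> bool" where
  "is_holonomy_map X \<gamma> h \<longleftrightarrow> (\<forall>u0 u1. holonomy_rel X \<gamma> u0 u1 \<longleftrightarrow> u1 = h u0)"

definition positive_loop_around :: "complex \<Rightarrow> (real \<Rightarrow> complex) \<Rightarrow> bool" where
  "positive_loop_around e \<gamma> \<longleftrightarrow> simple_path \<gamma> \<and> pathfinish \<gamma> = pathstart \<gamma> \<and>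
     e \<notin> path_image \<gamma> \<and> winding_number \<gamma> e = 1"

definition has_linear_holonomy :: "(C2 \<Rightarrow> C2) \<Rightarrow> complex \<Rightarrow> complex \<Rightarrow> bool" where
  "has_linear_holonomy X e \<mu> \<longleftrightarrow>
     (\<exists>r>0. \<forall>\<gamma>. positive_loop_around e \<gamma> \<and> path_image \<gamma> \<subseteq> ball e r \<longrightarrow>
        is_holonomy_map X \<gamma> (\<lambda>u. \<mu> * u))"

definition holomorphic2_on :: "(C2 \<Rightarrow> C2) \<Rightarrow> C2 set \<Rightarrow> bool" where
  "holomorphic2_on H U \<longleftrightarrow> (\<forall>p\<in>U. \<exists>A. (H has_derivative A) (at p within U) \<and>
     (\<forall>c v. A (cscale c v) = cscale c (A v)))"

definition local_biholomorphism :: "(C2 \<Rightarrow> C2) \<Rightarrow> C2 set \<Rightarrow> C2 set \<Rightarrow> C2 \<Rightarrow> bool" where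
  "local_biholomorphism H U V p \<longleftrightarrow>
     open U \<and> open V \<and> p \<in> U \<and> H p = 0 \<and> bij_betw H U V \<and>
     holomorphic2_on H U \<and> holomorphic2_on (inv_into U H) V"

definition flow_linearizable :: "(C2 \<Rightarrow> C2) \<Rightarrow> C2 \<Rightarrow> complex \<Rightarrow> complex \<Rightarrow> bool" where
  "flow_linearizable X p a b \<longleftrightarrow>
     (\<exists>H U V. local_biholomorphism H U V p \<and>
        (\<forall>t. \<forall>q\<in>U. \<forall>q'\<in>U.
           local_flow X U t q q' \<longleftrightarrow> local_flow (diag_map a b) V t (H q) (H q')))"

definition orbit_diagonalizable :: "(C2 \<Rightarrow> C2) \<Rightarrow> C2 \<Rightarrow> complex \<Rightarrow> complex \<Rightarrow> bool" where
  "orbit_diagonalizable X p a b \<longleftrightarrow>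
     (\<exists>H U V. local_biholomorphism H U V p \<and>
        (\<forall>q\<in>U. H ` local_orbit X U q = local_orbit (diag_map a b) V (H q)))"

text \<open>
  Multiplying \<open>f\<close> and \<open>g\<close> by \<open>exp (\<i> \<theta>)\<close> multiplies the blow-up field, hence its eigenvalues,
  by \<open>exp (\<i> \<theta>)\<close>; this is the substitution \<open>t = exp (\<i> \<theta>) s\<close> of complex time.
\<close>

definition rotated :: "real \<Rightarrow> complex poly poly \<Rightarrow> complex poly poly" where
  "rotated \<theta> p = smult [:cis \<theta>:] p"

definition time_rotation_related :: "real \<Rightarrow> (C2 \<Rightarrow> C2) \<Rightarrow> (C2 \<Rightarrow> C2) \<Rightarrow> bool" where
  "time_rotation_related \<theta> X Y \<longleftrightarrow>
     (\<forall>D \<eta>. is_solution X D \<eta> \<longleftrightarrow>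
        is_solution Y ((\<lambda>s. cis \<theta> * s) -` D) (\<lambda>s. \<eta> (cis \<theta> * s)))"

definition blowup_setting ::
    "nat \<Rightarrow> complex poly poly \<Rightarrow> complex poly poly \<Rightarrow> complex \<Rightarrow> bool" where
  "blowup_setting m f g e \<longleftrightarrow> m \<ge> 2 \<and> homogeneous m f \<and> homogeneous m g \<and>
     nondegenerate f g \<and> simple_zero (Ppoly f g) e"

definition real_eigenvalues ::
    "complex poly poly \<Rightarrow> complex poly poly \<Rightarrow> complex \<Rightarrow> bool" where
  "real_eigenvalues f g e \<longleftrightarrow> lambda1 f e \<in> \<real> \<and> lambda2 f g e \<in> \<real>"

end

theory Submission
  imports Defs
begin

text \<open>
  The blow-up field \<open>(- u f\<^sub>1(z), P(z))\<close> is a skew product: the \<open>z\<close>-equation is autonomous and the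
  \<open>u\<close>-equation is linear in \<open>u\<close>. Such a field is linearized near \<open>(0, e)\<close> by integrating two scalar
  equations. Near a simple zero \<open>e\<close> of \<open>P\<close> there is a holomorphic coordinate
  \<open>\<psi>(z) = (z - e) exp (Q z)\<close> with \<open>\<psi>' P = \<lambda>\<^sub>2 \<psi>\<close>, and a zero-free holomorphic factor \<open>k\<close> with
  \<open>k' P = (f\<^sub>1 + \<lambda>\<^sub>1) k\<close>; the quadratures have no pole at \<open>e\<close>, since \<open>f\<^sub>1 + \<lambda>\<^sub>1\<close> vanishes there.
  In the coordinates \<open>v = u k(z)\<close>, \<open>w = \<psi>(z)\<close> the field is \<open>(\<lambda>\<^sub>1 v, \<lambda>\<^sub>2 w)\<close>
  (lemma \<open>skew_field_linearization\<close>).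

  The map \<open>(u, z) \<mapsto> (v, w)\<close> is biholomorphic and relates the two fields, so it carries solutions to
  solutions in both directions. This gives the conjugacy of local flows
  (\<open>flow_linearizable_if_related\<close>) and the correspondence of local orbits
  (\<open>orbit_diagonalizable_if_related\<close>).

  In the linear system, following an orbit while \<open>log w\<close> grows by \<open>\<Delta>\<close> multiplies \<open>v\<close> by
  \<open>exp (\<lambda>\<^sub>1 \<Delta> / \<lambda>\<^sub>2)\<close> (\<open>diag_orbit_path_transport\<close>). A positive loop of \<open>z\<close> around \<open>e\<close> has
  \<open>\<Delta> = 2 \<pi> \<i>\<close>, and \<open>v = u k(z)\<close> is linear in \<open>u\<close>; hence the holonomy is linear with the stated
  multiplier (\<open>skew_field_linear_holonomy\<close>).

  If the spectral ratio is real, one complex rotation of time makes both eigenvalues real; it is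
  realized by multiplying \<open>f\<close> and \<open>g\<close> with the same unit complex number, which preserves the
  setting and the ratio.
\<close>

section \<open>Holomorphic maps that relate two vector fields\<close>

text \<open>
  \<open>H\<close> pushes \<open>X\<close> forward to \<open>Y\<close>. The derivative \<open>A\<close> has to be complex linear, because solutions
  in complex time have velocity \<open>h X\<close> in every complex direction \<open>h\<close>.
\<close>

definition field_related ::
    "(C2 \<Rightarrow> C2) \<Rightarrow> C2 set \<Rightarrow> (C2 \<Rightarrow> C2) \<Rightarrow> (C2 \<Rightarrow> C2) \<Rightarrow> bool" where
  "field_related H U X Y \<longleftrightarrow>
     (\<forall>p\<in>U. \<exists>A. (H has_derivative A) (at p) \<and>
        (\<forall>c v. A (cscale c v) = cscale c (A v)) \<and> A (X p) = Y (H p))"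

lemma is_solution_compose:
  assumes "field_related H U X Y" "is_solution X D \<eta>" "\<eta> ` D \<subseteq> U"
  shows "is_solution Y D (H \<circ> \<eta>)"
  unfolding is_solution_def
proof (intro conjI ballI)
  show "open D" "connected D" using assms(2) by (auto simp: is_solution_def)
  fix t assume t: "t \<in> D"
  then obtain A where A: "(H has_derivative A) (at (\<eta> t))"
      "\<And>c v. A (cscale c v) = cscale c (A v)" "A (X (\<eta> t)) = Y (H (\<eta> t))"
    using assms(1,3) unfolding field_related_def by blast
  have "(\<eta> has_derivative (\<lambda>h. cscale h (X (\<eta> t)))) (at t)"
    using assms(2) t by (auto simp: is_solution_def)
  from has_derivative_compose[OF this A(1)]
  show "(H \<circ> \<eta> has_derivative (\<lambda>h. cscale h (Y ((H \<circ> \<eta>) t)))) (at t)"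
    by (simp add: A o_def)
qed

lemma is_solution_continuous_on:
  assumes "is_solution X D \<eta>"
  shows "continuous_on D \<eta>"
proof (rule continuous_at_imp_continuous_on, rule ballI)
  fix t assume "t \<in> D"
  then have "(\<eta> has_derivative (\<lambda>h. cscale h (X (\<eta> t)))) (at t)"
    using assms unfolding is_solution_def by blast
  then show "isCont \<eta> t" by (rule has_derivative_continuous)
qed

lemma is_solution_subset:
  "is_solution X D \<eta> \<Longrightarrow> open D' \<Longrightarrow> connected D' \<Longrightarrow> D' \<subseteq> D \<Longrightarrow> is_solution X D' \<eta>"
  unfolding is_solution_def by blast

text \<open>
  A local solution that represents \<open>c\<close> may leave \<open>U\<close>, where \<open>H\<close> says nothing. It is therefore
  cut down to a disc of times that it maps into \<open>U\<close>, and the parameter interval is shortened so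
  that the time path stays in this disc. Stating the equality of \<open>d\<close> and \<open>H \<circ> c\<close> only on
  \<open>[0, 1]\<close> allows \<open>d\<close> to be a path with a given closed form.
\<close>

lemma orbit_path_compose:
  assumes rel: "field_related H U X Y" and "open U"
    and c: "orbit_path X c" "c ` {0..1} \<subseteq> U"
    and d: "\<And>s. s \<in> {0..1} \<Longrightarrow> d s = H (c s)"
  shows "orbit_path Y d"
  unfolding orbit_path_def
proof
  fix s :: real assume s: "s \<in> {0..1}"
  with c(1) obtain \<epsilon> D \<eta> \<tau> where \<epsilon>: "\<epsilon> > 0" and sol: "is_solution X D \<eta>"
    and \<tau>: "continuous_on ({0..1} \<inter> ball s \<epsilon>) \<tau>"
    and rep: "\<And>s'. s' \<in> {0..1} \<inter> ball s \<epsilon> \<Longrightarrow> \<tau> s' \<in> D \<and> c s' = \<eta> (\<tau> s')"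
    unfolding orbit_path_def by meson
  have sin: "s \<in> {0..1} \<inter> ball s \<epsilon>" using s \<epsilon> by simp
  have "open (D \<inter> \<eta> -` U)"
    using sol \<open>open U\<close> is_solution_continuous_on[OF sol]
    by (intro continuous_open_preimage) (simp_all add: is_solution_def)
  moreover have "\<tau> s \<in> D \<inter> \<eta> -` U"
    using rep[OF sin] c(2) s by force
  ultimately obtain r where r: "r > 0" "ball (\<tau> s) r \<subseteq> D \<inter> \<eta> -` U"
    using open_contains_ball by meson
  obtain \<delta> where \<delta>: "\<delta> > 0"
      "\<And>s'. s' \<in> {0..1} \<inter> ball s \<epsilon> \<Longrightarrow> dist s' s < \<delta> \<Longrightarrow> dist (\<tau> s') (\<tau> s) < r"
    using \<tau> sin r(1) unfolding continuous_on_iff by meson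
  let ?\<epsilon> = "min \<epsilon> \<delta>"
  have "is_solution Y (ball (\<tau> s) r) (H \<circ> \<eta>)"
    by (rule is_solution_compose[OF rel is_solution_subset[OF sol]]) (use r in auto)
  moreover have "continuous_on ({0..1} \<inter> ball s ?\<epsilon>) \<tau>"
    by (rule continuous_on_subset[OF \<tau>]) auto
  moreover have "\<forall>s'\<in>{0..1} \<inter> ball s ?\<epsilon>. \<tau> s' \<in> ball (\<tau> s) r \<and> d s' = (H \<circ> \<eta>) (\<tau> s')"
    using rep \<delta>(2) d by (auto simp: dist_commute)
  moreover have "?\<epsilon> > 0" using \<epsilon> \<delta> by simp
  ultimately show "\<exists>\<epsilon>>0. \<exists>D \<eta> \<tau>. is_solution Y D \<eta> \<and> continuous_on ({0..1} \<inter> ball s \<epsilon>) \<tau> \<and>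
      (\<forall>s'\<in>{0..1} \<inter> ball s \<epsilon>. \<tau> s' \<in> D \<and> d s' = \<eta> (\<tau> s'))"
    by (intro exI[of _ ?\<epsilon>] exI[of _ "ball (\<tau> s) r"] exI[of _ "H \<circ> \<eta>"] exI[of _ \<tau>] conjI)
qed

text \<open>
  By the chain rule the derivatives \<open>A\<close> of \<open>H\<close> and \<open>B\<close> of its inverse satisfy \<open>B A = 1\<close>, so
  \<open>A X = Y\<close> turns into \<open>B Y = X\<close>. This makes every statement about pushing solutions forward
  available in both directions.
\<close>

lemma field_related_inv:
  assumes bih: "local_biholomorphism H U V p" and rel: "field_related H U X Y"
  shows "field_related (inv_into U H) V Y X"
  unfolding field_related_def
proof
  fix q assume q: "q \<in> V"
  let ?G = "inv_into U H"
  have op: "open U" "open V" and bij: "bij_betw H U V"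
    using bih by (auto simp: local_biholomorphism_def)
  have Gq: "?G q \<in> U" "H (?G q) = q"
    using bij q by (auto simp: bij_betw_def inv_into_into f_inv_into_f)
  obtain B where B: "(?G has_derivative B) (at q)" "\<And>c v. B (cscale c v) = cscale c (B v)"
    using bih q op unfolding local_biholomorphism_def holomorphic2_on_def
    by (metis at_within_open)
  obtain A where A: "(H has_derivative A) (at (?G q))" "A (X (?G q)) = Y q"
    using rel Gq unfolding field_related_def by metis
  have "((\<lambda>x. ?G (H x)) has_derivative (\<lambda>h. B (A h))) (at (?G q))"
    using has_derivative_compose[OF A(1), of ?G B] B(1) Gq by simp
  moreover have "((\<lambda>x. ?G (H x)) has_derivative (\<lambda>h. h)) (at (?G q))"
    by (rule has_derivative_transform_within_open[OF has_derivative_ident op(1) Gq(1)])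
       (use bij in \<open>auto simp: bij_betw_def\<close>)
  ultimately have "(\<lambda>h. B (A h)) = (\<lambda>h. h)" by (rule has_derivative_unique)
  then have "B (Y q) = X (?G q)" unfolding A(2)[symmetric] by (rule fun_cong)
  then show "\<exists>A. (?G has_derivative A) (at q) \<and> (\<forall>c v. A (cscale c v) = cscale c (A v)) \<and>
      A (Y q) = X (?G q)"
    using B by (intro exI[of _ B]) simp
qed

lemma biholomorphism_mapsto:
  assumes "local_biholomorphism H U V p"
  shows "q \<in> U \<Longrightarrow> H q \<in> V" "q \<in> U \<Longrightarrow> inv_into U H (H q) = q"
    "q' \<in> V \<Longrightarrow> inv_into U H q' \<in> U" "q' \<in> V \<Longrightarrow> H (inv_into U H q') = q'"
proof -
  have "inj_on H U" and V: "V = H ` U"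
    using assms unfolding local_biholomorphism_def bij_betw_def by simp_all
  then show "q \<in> U \<Longrightarrow> H q \<in> V" "q \<in> U \<Longrightarrow> inv_into U H (H q) = q"
    "q' \<in> V \<Longrightarrow> inv_into U H q' \<in> U" "q' \<in> V \<Longrightarrow> H (inv_into U H q') = q'"
    by (simp_all add: inv_into_into f_inv_into_f)
qed

lemma local_flow_map:
  assumes rel: "field_related H U X Y" and "\<And>q. q \<in> U \<Longrightarrow> H q \<in> V"
    and "local_flow X U t q q'"
  shows "local_flow Y V t (H q) (H q')"
proof -
  obtain D \<eta> where sol: "is_solution X D \<eta>" "\<eta> ` D \<subseteq> U"
      and "0 \<in> D" "t \<in> D" "\<eta> 0 = q" "\<eta> t = q'"
    using assms(3) unfolding local_flow_def by blast
  moreover have "(H \<circ> \<eta>) ` D \<subseteq> V"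
    unfolding image_comp[symmetric] using sol(2) assms(2) by blast
  ultimately show ?thesis
    using is_solution_compose[OF rel sol] unfolding local_flow_def
    by (metis comp_apply)
qed

lemma flow_linearizable_if_related:
  assumes bih: "local_biholomorphism H U V p"
    and rel: "field_related H U X (diag_map a b)"
  shows "flow_linearizable X p a b"
  unfolding flow_linearizable_def
proof (intro exI conjI allI ballI)
  note maps = biholomorphism_mapsto[OF bih]
  show "local_biholomorphism H U V p" by fact
  fix t q q' assume q: "q \<in> U" "q' \<in> U"
  show "local_flow X U t q q' \<longleftrightarrow> local_flow (diag_map a b) V t (H q) (H q')"
  proof
    assume "local_flow X U t q q'"
    then show "local_flow (diag_map a b) V t (H q) (H q')"
      by (rule local_flow_map[OF rel, rotated]) (rule maps)
  next
    assume "local_flow (diag_map a b) V t (H q) (H q')"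
    then have "local_flow X U t (inv_into U H (H q)) (inv_into U H (H q'))"
      by (rule local_flow_map[OF field_related_inv[OF bih rel], rotated]) (rule maps)
    then show "local_flow X U t q q'" by (simp add: maps q)
  qed
qed

lemma local_orbit_map:
  assumes rel: "field_related H U X Y" and U: "open U" "\<And>q. q \<in> U \<Longrightarrow> H q \<in> V"
    and "q' \<in> local_orbit X U q"
  shows "H q' \<in> local_orbit Y V (H q)"
proof -
  obtain c where c: "orbit_path X c" "c ` {0..1} \<subseteq> U" "pathstart c = q" "pathfinish c = q'"
    using assms(4) unfolding local_orbit_def by blast
  have "orbit_path Y (H \<circ> c)"
    by (rule orbit_path_compose[OF rel U(1) c(1,2)]) simp
  moreover have "(H \<circ> c) ` {0..1} \<subseteq> V"
    unfolding image_comp[symmetric] using c(2) U(2) by blast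
  ultimately show ?thesis
    using c(3,4) unfolding local_orbit_def
    by (auto simp: pathstart_compose pathfinish_compose intro!: exI[of _ "H \<circ> c"])
qed

lemma local_orbit_subset: "local_orbit X U q \<subseteq> U"
proof
  fix q' assume "q' \<in> local_orbit X U q"
  then obtain c :: "real \<Rightarrow> C2" where "c ` {0..1} \<subseteq> U" "q' = c 1"
    unfolding local_orbit_def pathfinish_def by blast
  then show "q' \<in> U" by (simp add: image_subset_iff del: split_paired_All)
qed

lemma orbit_diagonalizable_if_related:
  assumes bih: "local_biholomorphism H U V p"
    and rel: "field_related H U X (diag_map a b)"
  shows "orbit_diagonalizable X p a b"
  unfolding orbit_diagonalizable_def
proof (intro exI conjI ballI)
  note maps = biholomorphism_mapsto[OF bih]
  have op: "open U" "open V" using bih by (auto simp: local_biholomorphism_def)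
  show "local_biholomorphism H U V p" by fact
  fix q assume q: "q \<in> U"
  show "H ` local_orbit X U q = local_orbit (diag_map a b) V (H q)"
  proof (intro equalityI subsetI)
    fix y assume "y \<in> H ` local_orbit X U q"
    then show "y \<in> local_orbit (diag_map a b) V (H q)"
      by (auto intro: local_orbit_map[OF rel op(1) maps(1)])
  next
    fix y assume y: "y \<in> local_orbit (diag_map a b) V (H q)"
    have "inv_into U H y \<in> local_orbit X U (inv_into U H (H q))"
      by (rule local_orbit_map[OF field_related_inv[OF bih rel] op(2) maps(3) y])
    then have "inv_into U H y \<in> local_orbit X U q" by (simp only: maps(2)[OF q])
    moreover have "y = H (inv_into U H y)"
      using maps(4)[OF subsetD[OF local_orbit_subset y]] by (rule sym)
    ultimately show "y \<in> H ` local_orbit X U q" by (rule rev_image_eqI)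
  qed
qed

section \<open>Skew products over the second coordinate\<close>

text \<open>
  Both the blow-up field and the linearizing coordinates are linear in \<open>u\<close> with coefficients that
  depend on \<open>z\<close>, and have a second component that depends on \<open>z\<close> alone. The same form
  therefore describes the field and the coordinate change.
\<close>

definition skew_map :: "(complex \<Rightarrow> complex) \<Rightarrow> (complex \<Rightarrow> complex) \<Rightarrow> C2 \<Rightarrow> C2" where
  "skew_map k \<psi> = (\<lambda>(u, z). (u * k z, \<psi> z))"

lemma skew_map_has_derivative:
  assumes "(k has_field_derivative k') (at z)" "(\<psi> has_field_derivative \<psi>') (at z)"
  shows "(skew_map k \<psi> has_derivative
    (\<lambda>h. (fst h * k z + u * (k' * snd h), \<psi>' * snd h))) (at (u, z))"
proof -
  have k: "((\<lambda>p. k (snd p)) has_derivative (\<lambda>h. k' * snd h)) (at (u, z))"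
    by (rule has_derivative_compose[OF has_derivative_snd[OF has_derivative_ident]])
       (use assms(1) in \<open>simp add: has_field_derivative_def\<close>)
  have \<psi>: "((\<lambda>p. \<psi> (snd p)) has_derivative (\<lambda>h. \<psi>' * snd h)) (at (u, z))"
    by (rule has_derivative_compose[OF has_derivative_snd[OF has_derivative_ident]])
       (use assms(2) in \<open>simp add: has_field_derivative_def\<close>)
  show ?thesis
    unfolding skew_map_def case_prod_unfold
    using has_derivative_Pair[OF
        has_derivative_mult[OF has_derivative_fst[OF has_derivative_ident] k] \<psi>]
    by (simp add: add.commute)
qed

lemma skew_map_holomorphic2_on:
  assumes "k holomorphic_on S" "\<psi> holomorphic_on S" "open S"
  shows "holomorphic2_on (skew_map k \<psi>) (UNIV \<times> S)"
  unfolding holomorphic2_on_def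
proof
  fix p :: C2 assume "p \<in> UNIV \<times> S"
  then obtain u z where p: "p = (u, z)" "z \<in> S" by auto
  have "(skew_map k \<psi> has_derivative
    (\<lambda>h. (fst h * k z + u * (deriv k z * snd h), deriv \<psi> z * snd h))) (at p within UNIV \<times> S)"
    unfolding p(1)
    by (rule has_derivative_at_withinI, rule skew_map_has_derivative)
       (use holomorphic_derivI assms p(2) in blast)+
  then show "\<exists>A. (skew_map k \<psi> has_derivative A) (at p within UNIV \<times> S) \<and>
      (\<forall>c v. A (cscale c v) = cscale c (A v))"
    by (intro exI conjI) (assumption, auto simp: cscale_def algebra_simps)
qed

lemma holomorphic2_on_cong:
  assumes "holomorphic2_on G V" and eq: "\<And>q. q \<in> V \<Longrightarrow> H q = G q"
  shows "holomorphic2_on H V"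
  unfolding holomorphic2_on_def
proof
  fix q assume q: "q \<in> V"
  then obtain A where A: "(G has_derivative A) (at q within V)"
      "\<forall>c v. A (cscale c v) = cscale c (A v)"
    using assms(1) unfolding holomorphic2_on_def by blast
  have "(H has_derivative A) (at q within V)"
    by (rule has_derivative_transform[OF q eq A(1)])
  with A(2) show "\<exists>A. (H has_derivative A) (at q within V) \<and>
      (\<forall>c v. A (cscale c v) = cscale c (A v))"
    by blast
qed

text \<open>
  The inverse is again a skew product, with factor \<open>1 / (k \<circ> \<phi>)\<close> over the inverse \<open>\<phi>\<close> of \<open>\<psi>\<close>, so one
  computation of derivatives covers both directions. The \<open>u\<close>-fibre is all of \<open>\<complex>\<close>, which makes the
  holonomy below defined for every \<open>u\<^sub>0\<close>.
\<close>

lemma skew_map_local_biholomorphism: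
  assumes "open S" "e \<in> S" "k holomorphic_on S" "\<And>z. z \<in> S \<Longrightarrow> k z \<noteq> 0"
    and "\<psi> holomorphic_on S" "inj_on \<psi> S" "\<psi> e = 0"
  shows "local_biholomorphism (skew_map k \<psi>) (UNIV \<times> S) (UNIV \<times> \<psi> ` S) (0, e)"
proof -
  let ?H = "skew_map k \<psi>" and ?U = "(UNIV :: complex set) \<times> S"
    and ?V = "(UNIV :: complex set) \<times> \<psi> ` S"
  obtain \<phi> where \<phi>: "\<phi> holomorphic_on \<psi> ` S" "\<And>z. z \<in> S \<Longrightarrow> \<phi> (\<psi> z) = z"
    using holomorphic_has_inverse[OF assms(5,1,6)] by metis
  let ?G = "skew_map (\<lambda>w. inverse (k (\<phi> w))) \<phi>"
  have op: "open (\<psi> ` S)" by (rule open_mapping_thm3[OF assms(5,1,6)])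
  have GH: "?G (?H q) = q" if "q \<in> ?U" for q
    using that assms(4) \<phi>(2) by (auto simp: skew_map_def)
  have HG: "?G q \<in> ?U \<and> ?H (?G q) = q" if "q \<in> ?V" for q
    using that assms(4) \<phi>(2) by (auto simp: skew_map_def)
  have HV: "?H q \<in> ?V" if "q \<in> ?U" for q
    using that by (auto simp: skew_map_def)
  have bij: "bij_betw ?H ?U ?V"
    by (rule bij_betw_byWitness[where f' = ?G]) (use GH HG HV in blast)+
  have inv: "inv_into ?U ?H q = ?G q" if "q \<in> ?V" for q
    using that HG bij_betw_imp_inj_on[OF bij] by (metis inv_into_f_f)
  have "(\<lambda>w. k (\<phi> w)) holomorphic_on \<psi> ` S"
    using holomorphic_on_compose[OF \<phi>(1), of k] \<phi>(2) assms(3)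
    by (auto simp: o_def image_image cong: image_cong)
  then have "holomorphic2_on ?G ?V"
    using assms(4) \<phi> op
    by (intro skew_map_holomorphic2_on holomorphic_on_inverse) auto
  then have "holomorphic2_on (inv_into ?U ?H) ?V"
    by (rule holomorphic2_on_cong) (rule inv)
  moreover have "holomorphic2_on ?H ?U"
    by (rule skew_map_holomorphic2_on) fact+
  moreover have "?H (0, e) = 0" by (simp add: skew_map_def zero_prod_def \<open>\<psi> e = 0\<close>)
  moreover have "open ?U" "open ?V" "(0, e) \<in> ?U"
    using op assms(1,2) by (simp_all add: open_Times)
  ultimately show ?thesis
    using bij unfolding local_biholomorphism_def by blast
qed

text \<open>
  The two equations are the transport equations for coordinates \<open>v = u k(z)\<close>, \<open>w = \<psi>(z)\<close> in which
  the field \<open>(u N(z), P(z))\<close> becomes \<open>(a v, b w)\<close>.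
\<close>

lemma skew_map_field_related:
  assumes "\<And>z. z \<in> S \<Longrightarrow> (k has_field_derivative k' z) (at z)"
    and "\<And>z. z \<in> S \<Longrightarrow> (\<psi> has_field_derivative \<psi>' z) (at z)"
    and "\<And>z. z \<in> S \<Longrightarrow> k' z * P z = (a - N z) * k z"
    and "\<And>z. z \<in> S \<Longrightarrow> \<psi>' z * P z = b * \<psi> z"
  shows "field_related (skew_map k \<psi>) (UNIV \<times> S) (skew_map N P) (diag_map a b)"
  unfolding field_related_def
proof
  fix p :: C2 assume "p \<in> UNIV \<times> S"
  then obtain u z where p: "p = (u, z)" "z \<in> S" by auto
  let ?A = "\<lambda>h. (fst h * k z + u * (k' z * snd h), \<psi>' z * snd h)"
  have "u * N z * k z + u * (k' z * P z) = a * (u * k z)"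
    unfolding assms(3)[OF p(2)] by (simp add: algebra_simps)
  then have "?A (skew_map N P p) = diag_map a b (skew_map k \<psi> p)"
    using assms(4)[OF p(2)] by (simp add: p skew_map_def diag_map_def)
  moreover have "(skew_map k \<psi> has_derivative ?A) (at p)"
    unfolding p(1) using assms(1,2) p(2) by (intro skew_map_has_derivative)
  moreover have "\<forall>c v. ?A (cscale c v) = cscale c (?A v)"
    by (auto simp: cscale_def algebra_simps)
  ultimately show "\<exists>A. (skew_map k \<psi> has_derivative A) (at p) \<and>
      (\<forall>c v. A (cscale c v) = cscale c (A v)) \<and>
      A (skew_map N P p) = diag_map a b (skew_map k \<psi> p)"
    by blast
qed

section \<open>Linearization by quadrature\<close>

lemma poly_quotient_primitive:
  fixes p R :: "complex poly"
  assumes "\<And>z. z \<in> ball e r \<Longrightarrow> poly R z \<noteq> 0"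
  obtains Q where "\<And>z. z \<in> ball e r \<Longrightarrow> (Q has_field_derivative poly p z / poly R z) (at z)"
proof -
  have "(\<lambda>z. poly p z / poly R z) holomorphic_on ball e r"
    using assms by (intro holomorphic_intros) auto
  from holomorphic_convex_primitive'[OF convex_ball open_ball this]
  show ?thesis using that by (metis at_within_open open_ball)
qed

text \<open>
  The transport equations are solved by quadrature. Write \<open>P = (z - e) R\<close>; then \<open>R(e) = P'(e) = b\<close>,
  and with \<open>a = N(e)\<close> both \<open>b - R\<close> and \<open>a - N\<close> are divisible by \<open>z - e\<close>. Hence
  \<open>(log k)' = (a - N) / P\<close> and \<open>(log \<psi>)' = b / P = 1 / (z - e) + (b - R) / ((z - e) R)\<close> have
  right-hand sides that are holomorphic at \<open>e\<close>, up to the term \<open>1 / (z - e)\<close>, which integrates to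
  the factor \<open>z - e\<close> of \<open>\<psi>\<close>. The explicit form of \<open>\<psi>\<close> serves to compute its logarithm along
  loops around \<open>e\<close>.
\<close>

lemma skew_field_linearization:
  fixes N P :: "complex poly"
  assumes P0: "poly P e = 0" and P': "poly (pderiv P) e \<noteq> 0"
  obtains r k Q \<psi> where "r > 0" "\<And>z. z \<in> ball e r \<Longrightarrow> k z \<noteq> 0"
    "\<And>z. z \<in> ball e r \<Longrightarrow> poly P z = 0 \<Longrightarrow> z = e"
    "continuous_on (ball e r) Q" "\<And>z. \<psi> z = (z - e) * exp (Q z)"
    "local_biholomorphism (skew_map k \<psi>) (UNIV \<times> ball e r) (UNIV \<times> \<psi> ` ball e r) (0, e)"
    "field_related (skew_map k \<psi>) (UNIV \<times> ball e r) (skew_map (poly N) (poly P))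
       (diag_map (poly N e) (poly (pderiv P) e))"
proof -
  define a b where "a = poly N e" and "b = poly (pderiv P) e"
  obtain R where R: "P = [:-e, 1:] * R" using P0 unfolding poly_eq_0_iff_dvd by (rule dvdE)
  have Re: "poly R e = b" unfolding b_def R pderiv_mult by (simp add: pderiv_pCons)
  have "poly ([:b:] - R) e = 0" by (simp add: Re)
  then obtain p where p0: "[:b:] - R = [:-e, 1:] * p" unfolding poly_eq_0_iff_dvd by (rule dvdE)
  have p: "b - poly R z = (z - e) * poly p z" for z
    using arg_cong[OF p0, of "\<lambda>q. poly q z"] by (simp add: algebra_simps)
  have "poly ([:a:] - N) e = 0" by (simp add: a_def)
  then obtain n where n0: "[:a:] - N = [:-e, 1:] * n" unfolding poly_eq_0_iff_dvd by (rule dvdE)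
  have n: "a - poly N z = (z - e) * poly n z" for z
    using arg_cong[OF n0, of "\<lambda>q. poly q z"] by (simp add: algebra_simps)
  have "open {z. poly R z \<noteq> 0}" by (intro open_Collect_neq continuous_intros)
  moreover have "e \<in> {z. poly R z \<noteq> 0}" using P' by (simp add: Re b_def)
  ultimately obtain r0 where "r0 > 0" "ball e r0 \<subseteq> {z. poly R z \<noteq> 0}" by (rule openE)
  then have r0: "r0 > 0" "\<And>z. z \<in> ball e r0 \<Longrightarrow> poly R z \<noteq> 0" by blast+
  obtain Q where Q: "\<And>z. z \<in> ball e r0 \<Longrightarrow> (Q has_field_derivative poly p z / poly R z) (at z)"
    using poly_quotient_primitive[OF r0(2), where p = p] by blast
  obtain K where K: "\<And>z. z \<in> ball e r0 \<Longrightarrow> (K has_field_derivative poly n z / poly R z) (at z)"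
    using poly_quotient_primitive[OF r0(2), where p = n] by blast
  define k where "k = (\<lambda>z. exp (K z))"
  define \<psi> where "\<psi> = (\<lambda>z. (z - e) * exp (Q z))"
  have k': "(k has_field_derivative (poly n z / poly R z) * k z) (at z)" if "z \<in> ball e r0" for z
    unfolding k_def by (auto intro!: derivative_eq_intros K that)
  have \<psi>': "(\<psi> has_field_derivative b / poly R z * exp (Q z)) (at z)" if "z \<in> ball e r0" for z
  proof -
    have "(\<psi> has_field_derivative exp (Q z) + (z - e) * (exp (Q z) * (poly p z / poly R z))) (at z)"
      unfolding \<psi>_def by (rule derivative_eq_intros Q[OF that] refl)+ (simp add: algebra_simps)
    moreover have "exp (Q z) + (z - e) * (exp (Q z) * (poly p z / poly R z)) =
        (poly R z + (z - e) * poly p z) / poly R z * exp (Q z)"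
      using r0(2)[OF that] by (simp add: field_simps)
    ultimately show ?thesis by (simp add: p[symmetric])
  qed
  have hol: "\<psi> holomorphic_on ball e r0" "k holomorphic_on ball e r0"
    using \<psi>' k' by (meson holomorphic_on_open open_ball)+
  have "deriv \<psi> e = exp (Q e)"
    using DERIV_imp_deriv[OF \<psi>'[of e]] r0(1) P' Re by (simp add: b_def)
  then obtain r where r: "r > 0" "ball e r \<subseteq> ball e r0" "inj_on \<psi> (ball e r)"
    using has_complex_derivative_locally_injective[OF hol(1), of e] r0(1) by auto
  show ?thesis
  proof (rule that[of r k Q \<psi>])
    show "z = e" if "z \<in> ball e r" "poly P z = 0" for z
      using that r(2) r0(2)[of z] by (auto simp: R)
    show "continuous_on (ball e r) Q"
      using Q r(2) by (meson DERIV_isCont continuous_at_imp_continuous_on subsetD)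
    show "local_biholomorphism (skew_map k \<psi>) (UNIV \<times> ball e r) (UNIV \<times> \<psi> ` ball e r) (0, e)"
      by (rule skew_map_local_biholomorphism)
         (use r hol in \<open>auto simp: k_def \<psi>_def intro: holomorphic_on_subset\<close>)
    show "field_related (skew_map k \<psi>) (UNIV \<times> ball e r) (skew_map (poly N) (poly P))
       (diag_map (poly N e) (poly (pderiv P) e))"
    proof (rule skew_map_field_related)
      fix z assume "z \<in> ball e r"
      then have z: "z \<in> ball e r0" using r(2) by blast
      show "(k has_field_derivative (poly n z / poly R z) * k z) (at z)" by (rule k'[OF z])
      show "(\<psi> has_field_derivative b / poly R z * exp (Q z)) (at z)" by (rule \<psi>'[OF z])
      have P: "poly P z = (z - e) * poly R z" by (simp add: R algebra_simps)
      show "poly n z / poly R z * k z * poly P z = (poly N e - poly N z) * k z"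
        unfolding a_def[symmetric] n using r0(2)[OF z] by (simp add: P)
      show "b / poly R z * exp (Q z) * poly P z = poly (pderiv P) e * \<psi> z"
        unfolding b_def[symmetric] \<psi>_def using r0(2)[OF z] by (simp add: P)
    qed
  qed (use r in \<open>auto simp: k_def \<psi>_def\<close>)
qed

section \<open>Transport in the diagonal linear system\<close>

lemma exp_minus_mult_eqD:
  fixes x y u v :: complex
  assumes "exp (- x) * u = exp (- y) * v"
  shows "u = exp (x - y) * v"
  using assms by (simp add: exp_minus exp_diff divide_inverse) (simp add: field_simps)

lemma diag_solution:
  assumes sol: "is_solution (diag_map a b) D \<eta>" and t: "t \<in> D" "t' \<in> D"
  shows "fst (\<eta> t') = exp (a * (t' - t)) * fst (\<eta> t)"
    and "snd (\<eta> t') = exp (b * (t' - t)) * snd (\<eta> t)"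
proof -
  have exponential: "y t' = exp (m * (t' - t)) * y t"
    if y: "\<And>s. s \<in> D \<Longrightarrow> (y has_field_derivative m * y s) (at s)" for y m
  proof -
    have der: "((\<lambda>s. exp (- m * s) * y s) has_field_derivative 0) (at s)" if "s \<in> D" for s
      by (rule derivative_eq_intros y that refl)+ simp
    then have "continuous_on D (\<lambda>s. exp (- m * s) * y s)"
      by (meson DERIV_isCont continuous_at_imp_continuous_on)
    then have "(\<lambda>s. exp (- m * s) * y s) constant_on D"
      using sol der unfolding is_solution_def
      by (intro DERIV_zero_connected_constant_on[of _ "{}"]) auto
    then have "exp (- m * t') * y t' = exp (- m * t) * y t"
      using t unfolding constant_on_def by metis
    then show ?thesis using exp_minus_mult_eqD[of "m * t'" _ "m * t"]
      by (simp add: right_diff_distrib)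
  qed
  have der: "(\<eta> has_derivative (\<lambda>h. cscale h (diag_map a b (\<eta> s)))) (at s)" if "s \<in> D" for s
    using sol that unfolding is_solution_def by blast
  have "((\<lambda>s. fst (\<eta> s)) has_field_derivative a * fst (\<eta> s)) (at s)" if "s \<in> D" for s
    using has_derivative_fst[OF der[OF that]]
    by (simp add: has_field_derivative_def cscale_def diag_map_def case_prod_unfold mult_commute_abs)
  then show "fst (\<eta> t') = exp (a * (t' - t)) * fst (\<eta> t)" by (rule exponential)
  have "((\<lambda>s. snd (\<eta> s)) has_field_derivative b * snd (\<eta> s)) (at s)" if "s \<in> D" for s
    using has_derivative_snd[OF der[OF that]]
    by (simp add: has_field_derivative_def cscale_def diag_map_def case_prod_unfold mult_commute_abs)
  then show "snd (\<eta> t') = exp (b * (t' - t)) * snd (\<eta> t)" by (rule exponential)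
qed

lemma diag_orbit_path:
  assumes "continuous_on {0..1} \<tau>"
  shows "orbit_path (diag_map a b) (\<lambda>s. (x * exp (a * \<tau> s), y * exp (b * \<tau> s)))"
proof -
  let ?\<eta> = "\<lambda>t. (x * exp (a * t), y * exp (b * t))"
  have "(?\<eta> has_derivative (\<lambda>h. cscale h (diag_map a b (?\<eta> t)))) (at t)" for t
  proof -
    have exp_der: "((\<lambda>t. c * exp (m * t)) has_derivative (\<lambda>h. h * (m * (c * exp (m * t))))) (at t)"
      for c m :: complex
      by (rule has_derivative_eq_rhs, (rule derivative_intros)+) (simp add: algebra_simps)
    show ?thesis
      using has_derivative_Pair[OF exp_der exp_der] by (simp add: cscale_def diag_map_def)
  qed
  then have "is_solution (diag_map a b) UNIV ?\<eta>"
    unfolding is_solution_def by (simp add: connected_UNIV)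
  then show ?thesis
    unfolding orbit_path_def
    by (intro ballI exI[of _ "1::real"] exI[of _ UNIV] exI[of _ ?\<eta>] exI[of _ \<tau>] conjI)
       (auto intro: continuous_on_subset[OF assms])
qed

text \<open>
  Along an orbit of \<open>v' = a v\<close>, \<open>w' = b w\<close> the multivalued first integral given by \<open>v\<close> times
  \<open>w\<close> to the power \<open>- a / b\<close> is constant. A continuous logarithm \<open>L\<close> of \<open>w\<close> selects its branch
  \<open>exp (- (a / b) L) v\<close>, so the change of \<open>v\<close> depends only on the increment of \<open>L\<close>.
\<close>

lemma diag_orbit_path_transport:
  assumes c: "orbit_path (diag_map a b) c" and "b \<noteq> 0"
    and L: "continuous_on {0..1} L" "\<And>s. s \<in> {0..1} \<Longrightarrow> snd (c s) = exp (L s)"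
  shows "fst (c 1) = exp (a / b * (L 1 - L 0)) * fst (c 0)"
proof -
  define J where "J = (\<lambda>s. exp (- (a / b) * L s) * fst (c s))"
  have "J 0 = J 1"
  proof (rule connected_local_const[of "{0..1::real}"])
    show "\<forall>s\<in>{0..1}. \<forall>\<^sub>F s' in at s within {0..1}. J s = J s'"
    proof
      fix s :: real assume s: "s \<in> {0..1}"
      obtain \<epsilon> D \<eta> \<tau> where \<epsilon>: "\<epsilon> > 0" and sol: "is_solution (diag_map a b) D \<eta>"
        and \<tau>: "continuous_on ({0..1} \<inter> ball s \<epsilon>) \<tau>"
        and rep: "\<And>s'. s' \<in> {0..1} \<inter> ball s \<epsilon> \<Longrightarrow> \<tau> s' \<in> D \<and> c s' = \<eta> (\<tau> s')"
        using c s unfolding orbit_path_def by meson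
      let ?I = "{0..1} \<inter> ball s \<epsilon>"
      have sin: "s \<in> ?I" using s \<epsilon> by simp
      \<comment> \<open>\<open>L\<close> and \<open>b \<tau>\<close> are logarithms of \<open>w\<close> up to a constant factor, so they differ by a continuous
        function that is constant modulo \<open>2 \<pi> \<i>\<close>. Near \<open>s\<close> its variation is below \<open>\<pi>\<close>, where
        \<open>exp\<close> is injective.\<close>
      define E where "E = (\<lambda>s'. L s' - b * \<tau> s')"
      have "continuous_on ?I E"
        unfolding E_def by (intro continuous_intros \<tau> continuous_on_subset[OF L(1)]) auto
      then obtain \<delta> where \<delta>: "\<delta> > 0" "\<And>s'. s' \<in> ?I \<Longrightarrow> dist s' s < \<delta> \<Longrightarrow> dist (E s') (E s) < pi"
        using sin pi_gt_zero unfolding continuous_on_iff by meson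
      have "J s = J s'" if s': "s' \<in> {0..1}" "dist s' s < min \<epsilon> \<delta>" for s'
      proof -
        have s'in: "s' \<in> ?I" using s' by (simp add: dist_commute)
        have flow: "fst (c s') = exp (a * (\<tau> s' - \<tau> s)) * fst (c s)"
            "snd (c s') = exp (b * (\<tau> s' - \<tau> s)) * snd (c s)"
          using diag_solution[OF sol, of "\<tau> s" "\<tau> s'"] rep[OF sin] rep[OF s'in] by auto
        have "exp (L s') = exp (b * (\<tau> s' - \<tau> s) + L s)"
          using flow(2) L(2) s s'(1) by (simp add: exp_add)
        then have "exp (L s' - b * \<tau> s') = exp (b * (\<tau> s' - \<tau> s) + L s - b * \<tau> s')"
          by (simp add: exp_diff)
        then have "exp (E s') = exp (E s)" unfolding E_def by (simp add: algebra_simps)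
        moreover have "E s' \<in> ball (E s) pi" "E s \<in> ball (E s) pi"
          using \<delta>(2)[OF s'in] s'(2) by (simp_all add: dist_commute)
        ultimately have "E s' = E s" using inj_on_exp_pi unfolding inj_on_def by blast
        then have "L s' = L s + b * (\<tau> s' - \<tau> s)" unfolding E_def by (simp add: algebra_simps)
        then have "a / b * L s' = a / b * L s + a * (\<tau> s' - \<tau> s)"
          using \<open>b \<noteq> 0\<close> by (simp add: distrib_left)
        then have "exp (- (a / b) * L s') * exp (a * (\<tau> s' - \<tau> s)) = exp (- (a / b) * L s)"
          unfolding exp_add[symmetric] by simp
        then show ?thesis unfolding J_def flow(1) by (metis mult.assoc)
      qed
      moreover have "min \<epsilon> \<delta> > 0" using \<epsilon> \<delta> by simp
      ultimately show "\<forall>\<^sub>F s' in at s within {0..1}. J s = J s'"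
        unfolding eventually_at by blast
    qed
  qed auto
  then show ?thesis
    using exp_minus_mult_eqD[of "a / b * L 1" _ "a / b * L 0"]
    by (simp add: J_def right_diff_distrib)
qed

section \<open>Linear holonomy\<close>

text \<open>
  For a loop \<open>\<gamma>\<close> with winding number \<open>1\<close> around \<open>e\<close>, \<open>log (\<gamma> - e)\<close> has a continuous branch \<open>q\<close>
  that increases by \<open>2 \<pi> \<i>\<close>. As \<open>\<psi>(z) = (z - e) exp (Q z)\<close> with single-valued \<open>Q\<close>, the branch
  \<open>L = q + Q \<circ> \<gamma>\<close> of \<open>log (\<psi> \<circ> \<gamma>)\<close> has the same increment. Transport in the linearizing
  coordinates then multiplies \<open>v = u k(z)\<close> by \<open>exp (2 \<pi> \<i> a / b)\<close>, and \<open>k\<close> cancels because \<open>\<gamma>\<close> is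
  closed. Since \<open>\<gamma>\<close> is merely continuous, the orbit over it is not found by integrating along \<open>\<gamma>\<close>,
  but by running the linear flow along the continuous complex time path \<open>(L - L(0)) / b\<close>.
\<close>

lemma skew_field_linear_holonomy:
  fixes N P :: "complex poly"
  assumes P0: "poly P e = 0" and P': "poly (pderiv P) e \<noteq> 0"
  shows "has_linear_holonomy (skew_map (poly N) (poly P)) e
    (exp (2 * of_real pi * \<i> * (poly N e / poly (pderiv P) e)))"
proof -
  define a b where "a = poly N e" and "b = poly (pderiv P) e"
  let ?X = "skew_map (poly N) (poly P)"
  let ?\<mu> = "exp (2 * of_real pi * \<i> * (a / b))"
  obtain r k Q \<psi> where r: "r > 0" and k0: "\<And>z. z \<in> ball e r \<Longrightarrow> k z \<noteq> 0"
    and Pz: "\<And>z. z \<in> ball e r \<Longrightarrow> poly P z = 0 \<Longrightarrow> z = e"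
    and Q: "continuous_on (ball e r) Q" and \<psi>: "\<And>z. \<psi> z = (z - e) * exp (Q z)"
    and bih: "local_biholomorphism (skew_map k \<psi>) (UNIV \<times> ball e r) (UNIV \<times> \<psi> ` ball e r) (0, e)"
    and rel: "field_related (skew_map k \<psi>) (UNIV \<times> ball e r) ?X (diag_map a b)"
    using skew_field_linearization[OF assms, of N] unfolding a_def b_def by metis
  let ?H = "skew_map k \<psi>" and ?U = "(UNIV :: complex set) \<times> ball e r"
    and ?V = "(UNIV :: complex set) \<times> \<psi> ` ball e r"
  have op: "open ?U" "open ?V" using bih unfolding local_biholomorphism_def by simp_all
  have b0: "b \<noteq> 0" using P' by (simp add: b_def)
  have "is_holonomy_map ?X \<gamma> (\<lambda>u. ?\<mu> * u)"
    if \<gamma>: "positive_loop_around e \<gamma>" "path_image \<gamma> \<subseteq> ball e r" for \<gamma>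
  proof -
    have \<gamma>': "path \<gamma>" "e \<notin> path_image \<gamma>" "winding_number \<gamma> e = 1" and loop: "\<gamma> 1 = \<gamma> 0"
      using \<gamma>(1) simple_path_imp_path
      by (auto simp: positive_loop_around_def pathstart_def pathfinish_def)
    have \<gamma>in: "\<gamma> s \<in> ball e r" "\<gamma> s \<noteq> e" if "s \<in> {0..1}" for s
      using that subsetD[OF \<gamma>(2)] \<gamma>'(2) unfolding path_image_def by blast+
    obtain q where q: "path q" "q 1 - q 0 = 2 * of_real pi * \<i>"
        "\<And>s. s \<in> {0..1} \<Longrightarrow> \<gamma> s = e + exp (q s)"
      using winding_number_as_continuous_log[OF \<gamma>'(1,2)] \<gamma>'(3)
      by (auto simp: pathstart_def pathfinish_def)
    define L where "L = (\<lambda>s. q s + Q (\<gamma> s))"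
    have "continuous_on {0..1} (\<lambda>s. Q (\<gamma> s))"
      using \<gamma>'(1) \<gamma>in(1) unfolding path_def
      by (intro continuous_on_compose2[OF Q]) auto
    then have L: "continuous_on {0..1} L"
      unfolding L_def using q(1) by (auto simp: path_def intro: continuous_on_add)
    have expL: "exp (L s) = \<psi> (\<gamma> s)" if "s \<in> {0..1}" for s
      unfolding L_def \<psi> exp_add using q(3)[OF that] by simp
    have L01: "L 1 - L 0 = 2 * of_real pi * \<i>"
      unfolding L_def loop using q(2) by (simp add: algebra_simps)
    have "u1 = ?\<mu> * u0" if hol: "holonomy_rel ?X \<gamma> u0 u1" for u0 u1
    proof -
      obtain c where c: "leaf_path ?X c" "\<And>s. s \<in> {0..1} \<Longrightarrow> snd (c s) = \<gamma> s"
          and ends: "c 0 = (u0, \<gamma> 0)" "c 1 = (u1, \<gamma> 0)"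
        using hol loop unfolding holonomy_rel_def pathstart_def pathfinish_def by metis
      have "c s \<in> ?U" if "s \<in> {0..1}" for s
        using c(2)[OF that] \<gamma>in(1)[OF that] by (simp add: mem_Times_iff)
      then have cU: "c ` {0..1} \<subseteq> ?U" by blast
      have orb: "orbit_path (diag_map a b) (?H \<circ> c)"
        by (rule orbit_path_compose[OF rel op(1) _ cU])
           (use c(1) in \<open>simp_all add: leaf_path_def\<close>)
      have "snd ((?H \<circ> c) s) = exp (L s)" if "s \<in> {0..1}" for s
        using c(2)[OF that] expL[OF that] by (simp add: skew_map_def case_prod_unfold)
      from diag_orbit_path_transport[OF orb b0 L this]
      have "u1 * k (\<gamma> 0) = ?\<mu> * (u0 * k (\<gamma> 0))"
        by (simp add: ends skew_map_def L01 mult.commute mult.left_commute)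
      then show ?thesis using k0[OF \<gamma>in(1), of 0] by simp
    qed
    moreover have "holonomy_rel ?X \<gamma> u0 (?\<mu> * u0)" for u0
    proof -
      define \<tau> where "\<tau> = (\<lambda>s. (L s - L 0) / b)"
      \<comment> \<open>\<open>d\<close> is the linear orbit over \<open>\<psi> \<circ> \<gamma>\<close>, and \<open>c\<close> is its preimage under the coordinates.\<close>
      define d where "d = (\<lambda>s. (u0 * k (\<gamma> 0) * exp (a * \<tau> s), exp (L 0) * exp (b * \<tau> s)))"
      define c where "c = (\<lambda>s. (u0 * k (\<gamma> 0) * exp (a * \<tau> s) / k (\<gamma> s), \<gamma> s))"
      have "continuous_on {0..1} \<tau>"
        unfolding \<tau>_def using b0 by (intro continuous_intros L) auto
      then have orb: "orbit_path (diag_map a b) d"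
        unfolding d_def by (rule diag_orbit_path)
      have cU: "c s \<in> ?U" if "s \<in> {0..1}" for s
        using \<gamma>in(1)[OF that] by (simp add: c_def mem_Times_iff)
      have Hc: "?H (c s) = d s" if "s \<in> {0..1}" for s
      proof -
        have "exp (L 0) * exp (b * \<tau> s) = exp (L s)"
          unfolding exp_add[symmetric] using b0 by (simp add: \<tau>_def)
        then show ?thesis
          using k0[OF \<gamma>in(1)[OF that]] expL[OF that] by (simp add: c_def d_def skew_map_def)
      qed
      have inv: "c s = inv_into ?U ?H (d s)" if "s \<in> {0..1}" for s
        using biholomorphism_mapsto(2)[OF bih cU[OF that]] Hc[OF that] by simp
      have dV: "d s \<in> ?V" if "s \<in> {0..1}" for s
        using biholomorphism_mapsto(1)[OF bih cU[OF that]] Hc[OF that] by simp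
      have "orbit_path ?X c"
        by (rule orbit_path_compose[OF field_related_inv[OF bih rel] op(2) orb])
           (use inv dV in blast)+
      moreover have "?X (c s) \<noteq> 0" if "s \<in> {0..1}" for s
        using Pz[OF \<gamma>in(1)[OF that]] \<gamma>in(2)[OF that]
        by (auto simp: c_def skew_map_def zero_prod_def)
      moreover have "c 0 = (u0, \<gamma> 0)"
        using k0[OF \<gamma>in(1), of 0] by (simp add: c_def \<tau>_def)
      moreover have "c 1 = (?\<mu> * u0, \<gamma> 1)"
        using k0[OF \<gamma>in(1), of 0] by (simp add: c_def \<tau>_def L01 loop mult.commute)
      ultimately show ?thesis
        unfolding holonomy_rel_def leaf_path_def pathstart_def pathfinish_def
        by (intro exI[of _ c]) (simp add: c_def)
    qed
    ultimately show ?thesis unfolding is_holonomy_map_def by blast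
  qed
  then show ?thesis
    unfolding has_linear_holonomy_def a_def[symmetric] b_def[symmetric] using r by blast
qed

section \<open>The blow-up field and complex time rotation\<close>

lemma blowup_field_eq_skew_map:
  "blowup_field f g = skew_map (poly (- dehom f)) (poly (Ppoly f g))"
  by (auto simp: blowup_field_def skew_map_def)

text \<open>
  If \<open>f(1, e) = 0\<close>, then \<open>P(e) = 0\<close> forces \<open>g(1, e) = 0\<close> as well, against nondegeneracy.
\<close>

lemma lambda1_nonzero:
  assumes "nondegenerate f g" "poly (Ppoly f g) e = 0"
  shows "lambda1 f e \<noteq> 0"
proof
  assume "lambda1 f e = 0"
  then have "eval2 f 1 e = 0" "eval2 g 1 e = 0"
    using assms(2) by (simp_all add: lambda1_def Ppoly_def dehom_def eval2_def)
  then show False using assms(1) unfolding nondegenerate_def by (metis zero_neq_one)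
qed

lemma simple_zero_iff:
  "simple_zero P e \<longleftrightarrow> poly P e = 0 \<and> poly (pderiv P) e \<noteq> 0"
proof (cases "P = 0 \<or> poly P e \<noteq> 0")
  case True
  then show ?thesis by (auto simp: simple_zero_def order_root)
next
  case False
  then have "pderiv P \<noteq> 0" using pderiv_eq_0_iff[of P] by (auto elim!: degree_eq_zeroE)
  then show ?thesis
    using False order_pderiv[of P e] order_root[of "pderiv P" e] by (auto simp: simple_zero_def)
qed

lemma eigenvalues_diag_map: "eigenvalues (diag_map a b) = {a, b}"
proof (intro equalityI subsetI)
  fix \<mu> assume "\<mu> \<in> eigenvalues (diag_map a b)"
  then show "\<mu> \<in> {a, b}"
    by (auto simp: eigenvalues_def diag_map_def cscale_def zero_prod_def)
next
  fix \<mu> assume "\<mu> \<in> {a, b}"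
  moreover have "diag_map a b (1, 0) = cscale a (1, 0)" "diag_map a b (0, 1) = cscale b (0, 1)"
    by (simp_all add: diag_map_def cscale_def)
  moreover have "(1, 0) \<noteq> (0 :: C2)" "(0, 1) \<noteq> (0 :: C2)" by (simp_all add: zero_prod_def)
  ultimately show "\<mu> \<in> eigenvalues (diag_map a b)"
    unfolding eigenvalues_def by blast
qed

lemma dehom_rotated: "dehom (rotated \<theta> p) = smult (cis \<theta>) (dehom p)"
  by (rule poly_eqI) (simp add: dehom_def subst_x_def rotated_def coeff_map_poly)

lemma Ppoly_rotated: "Ppoly (rotated \<theta> f) (rotated \<theta> g) = smult (cis \<theta>) (Ppoly f g)"
  by (simp add: Ppoly_def dehom_rotated smult_add_right)

lemma eval2_rotated: "eval2 (rotated \<theta> p) x y = cis \<theta> * eval2 p x y"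
  by (simp add: eval2_conv_poly_poly rotated_def)

lemma lambda1_rotated: "lambda1 (rotated \<theta> f) e = cis \<theta> * lambda1 f e"
  by (simp add: lambda1_def dehom_rotated)

lemma lambda2_rotated: "lambda2 (rotated \<theta> f) (rotated \<theta> g) e = cis \<theta> * lambda2 f g e"
  by (simp add: lambda2_def Ppoly_rotated pderiv_smult)

lemma spectral_ratio_rotated:
  "spectral_ratio (rotated \<theta> f) (rotated \<theta> g) e = spectral_ratio f g e"
  by (simp add: spectral_ratio_def lambda1_rotated lambda2_rotated)

lemma blowup_setting_rotated:
  assumes "blowup_setting m f g e"
  shows "blowup_setting m (rotated \<theta> f) (rotated \<theta> g) e"
proof -
  have "nondegenerate (rotated \<theta> f) (rotated \<theta> g) \<longleftrightarrow> nondegenerate f g"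
    by (simp add: nondegenerate_def eval2_rotated)
  moreover have "simple_zero (Ppoly (rotated \<theta> f) (rotated \<theta> g)) e \<longleftrightarrow> simple_zero (Ppoly f g) e"
    by (simp add: simple_zero_iff Ppoly_rotated pderiv_smult)
  moreover have "homogeneous m (rotated \<theta> p)" if "homogeneous m p" for p
    using that by (auto simp: homogeneous_def rotated_def)
  ultimately show ?thesis using assms unfolding blowup_setting_def by blast
qed

lemma blowup_field_rotated:
  "blowup_field (rotated \<theta> f) (rotated \<theta> g) p = cscale (cis \<theta>) (blowup_field f g p)"
  by (simp add: blowup_field_def cscale_def dehom_rotated Ppoly_rotated case_prod_unfold)

lemma is_solution_rescale:
  assumes "a \<noteq> 0" and sol: "is_solution X D \<eta>"
  shows "is_solution (\<lambda>p. cscale a (X p)) ((\<lambda>s. a * s) -` D) (\<lambda>s. \<eta> (a * s))"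
  unfolding is_solution_def
proof (intro conjI ballI)
  have D: "open D" "connected D" using sol by (auto simp: is_solution_def)
  have "(\<lambda>s. a * s) -` D = (\<lambda>t. t / a) ` D"
    using assms(1) by (auto simp: image_iff) (metis nonzero_mult_div_cancel_left)
  then show "connected ((\<lambda>s. a * s) -` D)"
    using D(2) assms(1) by (simp add: connected_continuous_image continuous_on_divide continuous_on_id)
  show "open ((\<lambda>s. a * s) -` D)"
    by (rule open_vimage[OF D(1)]) (intro continuous_intros)
  fix s assume "s \<in> (\<lambda>s. a * s) -` D"
  then have d: "(\<eta> has_derivative (\<lambda>h. cscale h (X (\<eta> (a * s))))) (at (a * s))"
    using sol by (auto simp: is_solution_def)
  have "((\<lambda>s. a * s) has_derivative (\<lambda>h. a * h)) (at s)"
    by (rule has_derivative_mult_right[OF has_derivative_ident])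
  from has_derivative_compose[OF this d]
  show "((\<lambda>s. \<eta> (a * s)) has_derivative (\<lambda>h. cscale h (cscale a (X (\<eta> (a * s)))))) (at s)"
    by (simp add: cscale_def mult.assoc mult.left_commute)
qed

lemma time_rotation_related_cis:
  "time_rotation_related \<theta> X (\<lambda>p. cscale (cis \<theta>) (X p))"
  unfolding time_rotation_related_def
proof (intro allI iffI)
  fix D \<eta>
  show "is_solution (\<lambda>p. cscale (cis \<theta>) (X p)) ((\<lambda>s. cis \<theta> * s) -` D) (\<lambda>s. \<eta> (cis \<theta> * s))"
    if "is_solution X D \<eta>"
    using that by (intro is_solution_rescale) auto
  assume "is_solution (\<lambda>p. cscale (cis \<theta>) (X p)) ((\<lambda>s. cis \<theta> * s) -` D) (\<lambda>s. \<eta> (cis \<theta> * s))"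
  from is_solution_rescale[OF _ this, of "inverse (cis \<theta>)"]
  show "is_solution X D \<eta>"
    by (simp add: cscale_def vimage_def mult.assoc[symmetric] cis_mult)
qed

text \<open>
  Rotate the argument of \<open>\<lambda>\<^sub>2\<close> to zero; \<open>\<lambda>\<^sub>1\<close> follows, being a real multiple of \<open>\<lambda>\<^sub>2\<close>.
\<close>

lemma rotation_to_real_eigenvalues:
  assumes "spectral_ratio f g e \<in> \<real>" "lambda2 f g e \<noteq> 0"
  shows "\<exists>\<theta>. real_eigenvalues (rotated \<theta> f) (rotated \<theta> g) e"
proof
  let ?\<theta> = "- Arg (lambda2 f g e)"
  have "cis ?\<theta> * lambda2 f g e = cis ?\<theta> * rcis (cmod (lambda2 f g e)) (Arg (lambda2 f g e))"
    by (simp add: rcis_cmod_Arg)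
  also have "\<dots> = of_real (cmod (lambda2 f g e))"
    by (simp add: rcis_def cis_mult)
  finally have l2: "lambda2 (rotated ?\<theta> f) (rotated ?\<theta> g) e \<in> \<real>"
    by (simp add: lambda2_rotated)
  have "lambda1 (rotated ?\<theta> f) e =
      spectral_ratio f g e * lambda2 (rotated ?\<theta> f) (rotated ?\<theta> g) e"
    using assms(2) by (simp add: spectral_ratio_def lambda1_rotated lambda2_rotated)
  then show "real_eigenvalues (rotated ?\<theta> f) (rotated ?\<theta> g) e"
    using l2 assms(1) by (simp add: real_eigenvalues_def)
qed

lemma blowup_conjugate_to_diagonal:
  assumes "blowup_setting m f g e"
  obtains H U V where "local_biholomorphism H U V (0, e)"
    "field_related H U (blowup_field f g) (diag_map (lambda1 f e) (lambda2 f g e))"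
proof -
  have "poly (Ppoly f g) e = 0" "poly (pderiv (Ppoly f g)) e \<noteq> 0"
    using assms by (simp_all add: blowup_setting_def simple_zero_iff)
  from skew_field_linearization[OF this, of "- dehom f"] show ?thesis
    using that unfolding blowup_field_eq_skew_map lambda1_def lambda2_def poly_minus by metis
qed

section \<open>Linearization, holonomy and orbit diagonalization at a simple zero\<close>

theorem theorem9p1:
  fixes m :: nat and f g :: "complex poly poly" and e :: complex
  assumes "blowup_setting m f g e"
  shows
    "(blowup_field f g (0, e) = 0 \<and>
      (blowup_field f g has_derivative diag_map (lambda1 f e) (lambda2 f g e)) (at (0, e)) \<and>
      eigenvalues (frechet_derivative (blowup_field f g) (at (0, e)))
        = {lambda1 f e, lambda2 f g e} \<and>
      lambda1 f e \<noteq> 0 \<and> lambda2 f g e \<noteq> 0) \<and>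
     has_linear_holonomy (blowup_field f g) e
       (exp (2 * of_real pi * \<i> * spectral_ratio f g e)) \<and>
     (nonresonant_node (spectral_ratio f g e) \<and> real_eigenvalues f g e \<longrightarrow>
       flow_linearizable (blowup_field f g) (0, e) (lambda1 f e) (lambda2 f g e)) \<and>
     (nonresonant_node (spectral_ratio f g e) \<and> \<not> real_eigenvalues f g e \<longrightarrow>
       (\<exists>\<theta>. time_rotation_related \<theta> (blowup_field f g)
               (blowup_field (rotated \<theta> f) (rotated \<theta> g)) \<and>
          blowup_setting m (rotated \<theta> f) (rotated \<theta> g) e \<and>
          nonresonant_node (spectral_ratio (rotated \<theta> f) (rotated \<theta> g) e) \<and>
          real_eigenvalues (rotated \<theta> f) (rotated \<theta> g) e \<and>
          flow_linearizable (blowup_field (rotated \<theta> f) (rotated \<theta> g)) (0, e)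
            (lambda1 (rotated \<theta> f) e) (lambda2 (rotated \<theta> f) (rotated \<theta> g) e))) \<and>
     (nonresonant_node (spectral_ratio f g e) \<and> \<not> real_eigenvalues f g e \<or>
      siegel_saddle (spectral_ratio f g e) \<longrightarrow>
        orbit_diagonalizable (blowup_field f g) (0, e) (lambda1 f e) (lambda2 f g e))"
proof -
  have P: "poly (Ppoly f g) e = 0" "poly (pderiv (Ppoly f g)) e \<noteq> 0"
    using assms by (simp_all add: blowup_setting_def simple_zero_iff)
  have l: "lambda1 f e \<noteq> 0" "lambda2 f g e \<noteq> 0"
    using assms lambda1_nonzero P
    by (auto simp: blowup_setting_def lambda2_def)
  have "(skew_map (poly (- dehom f)) (poly (Ppoly f g)) has_derivative
      (\<lambda>h. (fst h * poly (- dehom f) e + 0 * (poly (pderiv (- dehom f)) e * snd h),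
        poly (pderiv (Ppoly f g)) e * snd h))) (at (0, e))"
    by (rule skew_map_has_derivative) (rule poly_DERIV)+
  then have D: "(blowup_field f g has_derivative diag_map (lambda1 f e) (lambda2 f g e)) (at (0, e))"
    unfolding blowup_field_eq_skew_map
    by (simp add: diag_map_def lambda1_def lambda2_def case_prod_unfold mult.commute)
  have eig: "eigenvalues (frechet_derivative (blowup_field f g) (at (0, e))) =
      {lambda1 f e, lambda2 f g e}"
    unfolding frechet_derivative_at[OF D, symmetric] by (rule eigenvalues_diag_map)
  have equilibrium: "blowup_field f g (0, e) = 0"
    using P(1) by (simp add: blowup_field_def zero_prod_def)
  have holonomy: "has_linear_holonomy (blowup_field f g) e
      (exp (2 * of_real pi * \<i> * spectral_ratio f g e))"
    using skew_field_linear_holonomy[OF P, of "- dehom f"]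
    by (simp add: blowup_field_eq_skew_map spectral_ratio_def lambda1_def lambda2_def)
  have flow: "flow_linearizable (blowup_field f' g') (0, e) (lambda1 f' e) (lambda2 f' g' e)"
    if "blowup_setting m f' g' e" for f' g'
    using blowup_conjugate_to_diagonal[OF that] flow_linearizable_if_related by metis
  have orbit: "orbit_diagonalizable (blowup_field f g) (0, e) (lambda1 f e) (lambda2 f g e)"
    using blowup_conjugate_to_diagonal[OF assms] orbit_diagonalizable_if_related
    by metis
  have rotation: "\<exists>\<theta>. time_rotation_related \<theta> (blowup_field f g)
               (blowup_field (rotated \<theta> f) (rotated \<theta> g)) \<and>
          blowup_setting m (rotated \<theta> f) (rotated \<theta> g) e \<and>
          nonresonant_node (spectral_ratio (rotated \<theta> f) (rotated \<theta> g) e) \<and>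
          real_eigenvalues (rotated \<theta> f) (rotated \<theta> g) e \<and>
          flow_linearizable (blowup_field (rotated \<theta> f) (rotated \<theta> g)) (0, e)
            (lambda1 (rotated \<theta> f) e) (lambda2 (rotated \<theta> f) (rotated \<theta> g) e)"
    if node: "nonresonant_node (spectral_ratio f g e)"
  proof -
    have "spectral_ratio f g e \<in> \<real>" using node by (simp add: nonresonant_node_def)
    then obtain \<theta> where \<theta>: "real_eigenvalues (rotated \<theta> f) (rotated \<theta> g) e"
      using rotation_to_real_eigenvalues l(2) by blast
    have "blowup_field (rotated \<theta> f) (rotated \<theta> g) = (\<lambda>p. cscale (cis \<theta>) (blowup_field f g p))"
      by (rule ext) (rule blowup_field_rotated)
    then have "time_rotation_related \<theta> (blowup_field f g)
        (blowup_field (rotated \<theta> f) (rotated \<theta> g))"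
      by (simp add: time_rotation_related_cis)
    then show ?thesis
      using \<theta> node blowup_setting_rotated[OF assms] flow spectral_ratio_rotated by metis
  qed
  show ?thesis
    by (intro conjI impI equilibrium D eig l holonomy flow[OF assms] rotation orbit)
       (erule conjunct1)
qed

end
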